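(* Let $X$ and $Y$ be infinite dimensional complex Banach spaces, and let $S\in L(X)$ and $T\in L(Y)$. If $S$ and $T$ have property $(sbaw)$ and are a-isoloid, then the following assertions are equivalent: (i) $S\oplus T\in L(X\oplus Y)$ has property $(sbaw)$; (ii) $\sigma_{ubw}(S\oplus T)=\sigma_{ubw}(S)\cup\sigma_{ubw}(T)$.
   Context: $L(X)$ is the algebra of bounded linear operators on $X$. For a bounded operator $T$: $R(T)$ is the range, $\alpha(T)=\dim\ker T$, $\beta(T)=\operatorname{codim} R(T)$; $\sigma_a(T)$ is the approximate point spectrum; $\mathrm{iso}\,A$ is the set of isolated points of $A\subset\mathbb{C}$. $T$ is upper semi-Fredholm if $R(T)$ is closed and $\alpha(T)<\infty$, with index $\operatorname{ind}T=\alpha(T)-\beta(T)$; it is upper semi-Weyl if moreover $\operatorname{ind}T\le 0$. $T$ is upper semi b-Weyl if there is an integer $n\ge 0$ such that $R(T^n)$ is closed and the restriction $T_n:R(T^n)\to R(T^n)$ of $T$ is upper semi-Weyl. $\sigma_{ubw}(T)$ is the set of $\lambda\in\mathbb{C}$ such that $T-\lambda I$ is not upper semi b-Weyl. $\sigma_p^0(T)$ is the set of eigenvalues of $T$ of finite multiplicity ($0<\alpha(T-\lambda I)<\infty$), and $\pi_{00}^a(T)=\mathrm{iso}\,\sigma_a(T)\cap\sigma_p^0(T)$. $T$ satisfies property $(sbaw)$ if $\sigma_a(T)\setminus\sigma_{ubw}(T)=\pi_{00}^a(T)$. $T$ is a-isoloid if every isolated point of $\sigma_a(T)$ is an eigenvalue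 of $T$. *)

theory Defs
  imports "HOL-Analysis.Analysis"
begin

section \<open>Complex Banach spaces\<close>

text \<open>
  The distribution only has real normed spaces. A complex normed space is a real normed space with
  a complex scalar multiplication that extends the real one and is compatible with the norm.
\<close>

class scaleC =
  fixes scaleC :: "complex \<Rightarrow> 'a \<Rightarrow> 'a" (infixr \<open>*\<^sub>C\<close> 75)

class complex_normed_vector = real_normed_vector + scaleC +
  assumes scaleC_add_right: "a *\<^sub>C (x + y) = a *\<^sub>C x + a *\<^sub>C y"
    and scaleC_add_left: "(a + b) *\<^sub>C x = a *\<^sub>C x + b *\<^sub>C x"
    and scaleC_scaleC: "a *\<^sub>C (b *\<^sub>C x) = (a * b) *\<^sub>C x"
    and scaleC_of_real: "complex_of_real r *\<^sub>C x = r *\<^sub>R x"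
    and norm_scaleC: "norm (a *\<^sub>C x) = cmod a * norm x"

class complex_banach = complex_normed_vector + banach

lemma scaleC_one: "1 *\<^sub>C x = (x :: 'a :: complex_normed_vector)"
  using scaleC_of_real[of 1 x] by simp

global_interpretation complex_vector: vector_space "scaleC :: complex \<Rightarrow> 'a \<Rightarrow> 'a :: complex_normed_vector"
  defines cdependent_raw_def: cdependent = complex_vector.dependent
    and crepresentation_raw_def: crepresentation = complex_vector.representation
    and csubspace_raw_def: csubspace = complex_vector.subspace
    and cspan_raw_def: cspan = complex_vector.span
    and cextend_basis_raw_def: cextend_basis = complex_vector.extend_basis
    and cdim_raw_def: cdim = complex_vector.dim
  by unfold_locales (simp_all add: scaleC_add_right scaleC_add_left scaleC_scaleC scaleC_one)

text \<open>
  The direct sum of two spaces is their product type; the library norm on pairs is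
  \<open>sqrt (norm x ^ 2 + norm y ^ 2)\<close>.
\<close>

instantiation prod :: (complex_normed_vector, complex_normed_vector) complex_normed_vector
begin

definition scaleC_prod_def: "c *\<^sub>C p = (c *\<^sub>C fst p, c *\<^sub>C snd p)"

instance
proof
  fix a b :: complex and r :: real and x y :: "'a \<times> 'b"
  show "a *\<^sub>C (x + y) = a *\<^sub>C x + a *\<^sub>C y"
    by (simp add: scaleC_prod_def scaleC_add_right)
  show "(a + b) *\<^sub>C x = a *\<^sub>C x + b *\<^sub>C x"
    by (simp add: scaleC_prod_def scaleC_add_left)
  show "a *\<^sub>C (b *\<^sub>C x) = (a * b) *\<^sub>C x"
    by (simp add: scaleC_prod_def scaleC_scaleC)
  show "complex_of_real r *\<^sub>C x = r *\<^sub>R x"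
    by (simp add: scaleC_prod_def scaleC_of_real scaleR_prod_def)
  show "norm (a *\<^sub>C x) = cmod a * norm x"
    by (simp add: scaleC_prod_def norm_prod_def norm_scaleC power_mult_distrib
        flip: distrib_left)
      (simp add: real_sqrt_mult)
qed

end

instance prod :: (complex_banach, complex_banach) complex_banach ..

definition bounded_clinear ::
  "('a :: complex_normed_vector \<Rightarrow> 'b :: complex_normed_vector) \<Rightarrow> bool" where
  "bounded_clinear T \<longleftrightarrow> bounded_linear T \<and> (\<forall>c x. T (c *\<^sub>C x) = c *\<^sub>C T x)"


section \<open>Dimension and codimension\<close>

text \<open>
  The library dimension is \<open>0\<close> on infinite dimensional subspaces, so extended naturals are used.
\<close>

definition ecdim :: "'a :: complex_normed_vector set \<Rightarrow> enat" where
  "ecdim V = (if \<exists>B. finite B \<and> V \<subseteq> cspan B then enat (cdim V) else \<infinity>)"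

text \<open>
  \<open>ecodim V W\<close> is the dimension of \<open>V / W\<close> for subspaces \<open>W \<subseteq> V\<close>: the least number of vectors of
  \<open>V\<close> whose classes span \<open>V / W\<close>, and \<open>\<infinity>\<close> (the infimum of the empty set) if no finite set does.
  It agrees with the dimension of any algebraic complement, see \<open>ecodim_complement\<close> below.
\<close>

definition ecodim :: "'a :: complex_normed_vector set \<Rightarrow> 'a set \<Rightarrow> enat" where
  "ecodim V W = (INF B \<in> {B. finite B \<and> B \<subseteq> V \<and> V \<subseteq> cspan (W \<union> B)}. enat (card B))"

lemma ecodim_complement:
  fixes U V W :: "'a :: complex_normed_vector set"
  assumes U: "csubspace U" and W: "csubspace W" and UW: "U \<inter> W = {0}"
    and V: "V = {u + w | u w. u \<in> U \<and> w \<in> W}"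
  shows "ecodim V W = ecdim U"
proof (rule antisym)
  show "ecodim V W \<le> ecdim U"
  proof (cases "\<exists>B. finite B \<and> U \<subseteq> cspan B")
    case True
    then obtain C where C: "finite C" "U \<subseteq> cspan C" by blast
    obtain B where B: "B \<subseteq> U" "\<not> cdependent B" "U \<subseteq> cspan B" "card B = cdim U"
      using complex_vector.basis_exists by blast
    have fin: "finite B"
      using complex_vector.independent_span_bound[of C B] C B by blast
    have "U \<subseteq> V"
      using V complex_vector.subspace_0[OF W] by force
    moreover have "V \<subseteq> cspan (W \<union> B)"
    proof
      fix x assume "x \<in> V"
      then obtain u w where x: "x = u + w" "u \<in> U" "w \<in> W" using V by blast
      have "u \<in> cspan (W \<union> B)"
        using x B complex_vector.span_mono[of B "W \<union> B"] by auto
      moreover have "w \<in> cspan (W \<union> B)"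
        using x by (simp add: complex_vector.span_base)
      ultimately show "x \<in> cspan (W \<union> B)"
        using x complex_vector.span_add by blast
    qed
    ultimately have "ecodim V W \<le> enat (card B)"
      unfolding ecodim_def using fin B by (intro INF_lower) auto
    then show ?thesis using True B by (simp add: ecdim_def)
  next
    case False
    then have "ecdim U = \<infinity>" unfolding ecdim_def by (rule if_not_P)
    then show ?thesis by simp
  qed
next
  show "ecdim U \<le> ecodim V W"
    unfolding ecodim_def
  proof (rule INF_greatest, clarify)
    fix B assume B: "finite B" "B \<subseteq> V" "V \<subseteq> cspan (W \<union> B)"
    have "\<forall>b\<in>B. \<exists>u\<in>U. b - u \<in> W" using B V by force
    then obtain p where p: "\<And>b. b \<in> B \<Longrightarrow> p b \<in> U" "\<And>b. b \<in> B \<Longrightarrow> b - p b \<in> W"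
      by metis
    have key: "\<exists>y\<in>cspan (p ` B). x - y \<in> W" if "x \<in> cspan (W \<union> B)" for x
      using that
    proof (induction rule: complex_vector.span_induct_alt)
      case base
      show ?case
        using complex_vector.span_zero complex_vector.subspace_0[OF W] by force
    next
      case (step c x y)
      then obtain y' where y': "y' \<in> cspan (p ` B)" "y - y' \<in> W" by blast
      obtain x' where x': "x' \<in> cspan (p ` B)" "x - x' \<in> W"
      proof (cases "x \<in> W")
        case True
        then show ?thesis using that[of 0] complex_vector.span_zero[of "p ` B"] by simp
      next
        case False
        then show ?thesis using that[of "p x"] step p complex_vector.span_base by blast
      qed
      have "(c *\<^sub>C x + y) - (c *\<^sub>C x' + y') = c *\<^sub>C (x - x') + (y - y')"
        by (simp add: complex_vector.scale_right_diff_distrib)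
      then show ?case
        using x' y' complex_vector.span_add complex_vector.span_scale
          complex_vector.subspace_add[OF W] complex_vector.subspace_scale[OF W] by metis
    qed
    have "U \<subseteq> cspan (p ` B)"
    proof
      fix u assume u: "u \<in> U"
      then have "u \<in> V" using V complex_vector.subspace_0[OF W] by force
      then obtain y where y: "y \<in> cspan (p ` B)" "u - y \<in> W" using key B by blast
      have "cspan (p ` B) \<subseteq> U"
        using p(1) U by (intro complex_vector.span_minimal) auto
      then have "u - y \<in> U \<inter> W"
        using y u complex_vector.subspace_diff[OF U] by blast
      then show "u \<in> cspan (p ` B)" using UW y by auto
    qed
    moreover from this have "cdim U \<le> card B"
      using complex_vector.dim_le_card[of U "p ` B"] card_image_le[of B p] B by simp
    ultimately show "ecdim U \<le> enat (card B)"
      using B by (auto simp: ecdim_def)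
  qed
qed


section \<open>Upper semi-Fredholm and upper semi b-Weyl operators\<close>

text \<open>
  The notions are stated for the restriction of \<open>T\<close> to a \<open>T\<close>-invariant subspace \<open>M\<close>, viewed as an
  operator from \<open>M\<close> to \<open>M\<close>; an operator on the whole space is the case \<open>M = UNIV\<close>.
\<close>

definition nullity_on :: "'a :: complex_normed_vector set \<Rightarrow> ('a \<Rightarrow> 'a) \<Rightarrow> enat" where
  "nullity_on M T = ecdim {x \<in> M. T x = 0}"

definition defect_on :: "'a :: complex_normed_vector set \<Rightarrow> ('a \<Rightarrow> 'a) \<Rightarrow> enat" where
  "defect_on M T = ecodim M (T ` M)"

definition upper_semi_Fredholm_on :: "'a :: complex_normed_vector set \<Rightarrow> ('a \<Rightarrow> 'a) \<Rightarrow> bool" where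
  "upper_semi_Fredholm_on M T \<longleftrightarrow>
     closedin (top_of_set M) (T ` M) \<and> nullity_on M T < \<infinity>"

text \<open>
  Only meaningful when the nullity is finite; the value is \<open>- \<infinity>\<close> if the defect is infinite.
\<close>

definition index_on :: "'a :: complex_normed_vector set \<Rightarrow> ('a \<Rightarrow> 'a) \<Rightarrow> ereal" where
  "index_on M T = ereal_of_enat (nullity_on M T) - ereal_of_enat (defect_on M T)"

definition upper_semi_Weyl_on :: "'a :: complex_normed_vector set \<Rightarrow> ('a \<Rightarrow> 'a) \<Rightarrow> bool" where
  "upper_semi_Weyl_on M T \<longleftrightarrow> upper_semi_Fredholm_on M T \<and> index_on M T \<le> 0"

definition upper_semi_b_Weyl :: "('a :: complex_normed_vector \<Rightarrow> 'a) \<Rightarrow> bool" where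
  "upper_semi_b_Weyl T \<longleftrightarrow>
     (\<exists>n. closed (range (T ^^ n)) \<and> upper_semi_Weyl_on (range (T ^^ n)) T)"


section \<open>Spectra\<close>

definition shift_op :: "('a :: complex_normed_vector \<Rightarrow> 'a) \<Rightarrow> complex \<Rightarrow> 'a \<Rightarrow> 'a" where
  "shift_op T \<mu> = (\<lambda>x. T x - \<mu> *\<^sub>C x)"

definition approx_point_spectrum :: "('a :: complex_normed_vector \<Rightarrow> 'a) \<Rightarrow> complex set" where
  "approx_point_spectrum T =
     {\<mu>. \<exists>x :: nat \<Rightarrow> 'a. (\<forall>n. norm (x n) = 1) \<and> (\<lambda>n. shift_op T \<mu> (x n)) \<longlonglongrightarrow> 0}"

definition usbw_spectrum :: "('a :: complex_normed_vector \<Rightarrow> 'a) \<Rightarrow> complex set" where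
  "usbw_spectrum T = {\<mu>. \<not> upper_semi_b_Weyl (shift_op T \<mu>)}"

definition is_eigenvalue :: "('a :: complex_normed_vector \<Rightarrow> 'a) \<Rightarrow> complex \<Rightarrow> bool" where
  "is_eigenvalue T \<mu> \<longleftrightarrow> (\<exists>x. x \<noteq> 0 \<and> T x = \<mu> *\<^sub>C x)"

definition fin_mult_eigenvalues :: "('a :: complex_normed_vector \<Rightarrow> 'a) \<Rightarrow> complex set" where
  "fin_mult_eigenvalues T =
     {\<mu>. 0 < nullity_on UNIV (shift_op T \<mu>) \<and> nullity_on UNIV (shift_op T \<mu>) < \<infinity>}"

definition pi00a :: "('a :: complex_normed_vector \<Rightarrow> 'a) \<Rightarrow> complex set" where
  "pi00a T = {\<mu>. \<mu> isolated_in approx_point_spectrum T} \<inter> fin_mult_eigenvalues T"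

definition property_sbaw :: "('a :: complex_normed_vector \<Rightarrow> 'a) \<Rightarrow> bool" where
  "property_sbaw T \<longleftrightarrow> approx_point_spectrum T - usbw_spectrum T = pi00a T"

definition a_isoloid :: "('a :: complex_normed_vector \<Rightarrow> 'a) \<Rightarrow> bool" where
  "a_isoloid T \<longleftrightarrow> (\<forall>\<mu>. \<mu> isolated_in approx_point_spectrum T \<longrightarrow> is_eigenvalue T \<mu>)"

end

theory Submission
  imports Defs
begin

text \<open>
  Everything happens at a fixed \<open>\<mu>\<close>. Call \<open>\<mu>\<close> regular for an operator if it lies outside the
  approximate point spectrum, that is, if the operator shifted by \<open>\<mu>\<close> is bounded below
  (\<open>notin_approx_point_spectrum_iff\<close>). On a Banach space such an operator is injective with
  closed range, so it is upper semi-Weyl and a fortiori upper semi b-Weyl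
  (\<open>usbw_spectrum_subset\<close>). Under property \<open>(sbaw)\<close> the complement of the upper semi b-Weyl
  spectrum therefore consists of the regular points together with \<open>pi00a\<close>.

  The approximate point spectrum of a direct sum is the union of those of the summands, and the
  kernel of a direct sum is the product of the kernels. Since the summands are a-isoloid, a
  non-regular \<open>\<mu>\<close> lies in \<open>pi00a\<close> of the direct sum exactly when, for each of the two summands,
  it is regular or lies in \<open>pi00a\<close> (\<open>pi00a_map_prod_iff\<close>); by the preceding paragraph, exactly
  when \<open>\<mu>\<close> avoids both upper semi b-Weyl spectra. Property \<open>(sbaw)\<close> of the direct sum
  says that, at each non-regular point, lying in \<open>pi00a\<close> is the same as avoiding the upper semi
  b-Weyl spectrum of the sum; hence it says that the upper semi b-Weyl spectrum of the sum and the
  union of those of the summands agree at such points. At regular points they agree anyway, as none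
  of the three upper semi b-Weyl spectra contains such a point.
\<close>

lemma bounded_linear_shift_op:
  fixes T :: "'a :: complex_normed_vector \<Rightarrow> 'a"
  assumes "bounded_clinear T"
  shows "bounded_linear (shift_op T \<mu>)"
proof -
  have "bounded_linear (\<lambda>x :: 'a. \<mu> *\<^sub>C x)"
  proof (rule bounded_linear_intro[where K = "cmod \<mu>"])
    fix r :: real and x y :: 'a
    show "\<mu> *\<^sub>C (x + y) = \<mu> *\<^sub>C x + \<mu> *\<^sub>C y"
      by (rule scaleC_add_right)
    show "\<mu> *\<^sub>C (r *\<^sub>R x) = r *\<^sub>R (\<mu> *\<^sub>C x)"
      by (simp flip: scaleC_of_real add: scaleC_scaleC mult.commute)
    show "norm (\<mu> *\<^sub>C x) \<le> norm x * cmod \<mu>"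
      by (simp add: norm_scaleC mult.commute)
  qed
  then show ?thesis
    using assms unfolding shift_op_def bounded_clinear_def by (intro bounded_linear_sub) auto
qed

lemma bounded_clinear_map_prod:
  fixes S :: "'a :: complex_normed_vector \<Rightarrow> 'a" and T :: "'b :: complex_normed_vector \<Rightarrow> 'b"
  assumes "bounded_clinear S" and "bounded_clinear T"
  shows "bounded_clinear (map_prod S T)"
proof -
  have "bounded_linear (\<lambda>p. (S (fst p), T (snd p)))"
    using assms unfolding bounded_clinear_def
    by (metis bounded_linear_Pair bounded_linear_compose bounded_linear_fst bounded_linear_snd)
  moreover have "(\<lambda>p. (S (fst p), T (snd p))) = map_prod S T"
    by (auto simp: fun_eq_iff)
  ultimately show ?thesis
    using assms by (auto simp: bounded_clinear_def scaleC_prod_def)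
qed

lemma shift_op_map_prod: "shift_op (map_prod S T) \<mu> = map_prod (shift_op S \<mu>) (shift_op T \<mu>)"
  by (auto simp: shift_op_def scaleC_prod_def fun_eq_iff)


section \<open>The approximate point spectrum\<close>

text \<open>
  Failure of every lower bound \<open>1 / (n + 1)\<close> yields, after normalization, a sequence of
  approximate eigenvectors.
\<close>

lemma notin_approx_point_spectrum_iff:
  fixes T :: "'a :: complex_normed_vector \<Rightarrow> 'a"
  assumes "bounded_clinear T"
  shows "\<mu> \<notin> approx_point_spectrum T \<longleftrightarrow> (\<exists>c>0. \<forall>x. c * norm x \<le> norm (shift_op T \<mu> x))"
proof
  interpret A: bounded_linear "shift_op T \<mu>"
    by (rule bounded_linear_shift_op[OF assms])
  assume notin: "\<mu> \<notin> approx_point_spectrum T"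
  show "\<exists>c>0. \<forall>x. c * norm x \<le> norm (shift_op T \<mu> x)"
  proof (rule ccontr)
    assume "\<not> ?thesis"
    then have "\<exists>x. norm (shift_op T \<mu> x) < inverse (real (Suc n)) * norm x" for n
      by (metis inverse_positive_iff_positive not_le of_nat_0_less_iff zero_less_Suc)
    then obtain x where x: "\<And>n. norm (shift_op T \<mu> (x n)) < inverse (real (Suc n)) * norm (x n)"
      by metis
    have pos: "norm (x n) > 0" for n
      using x[of n] by (cases "x n = 0") auto
    define u where "u n = (1 / norm (x n)) *\<^sub>R x n" for n
    have "norm (u n) = 1" for n
      using pos[of n] by (simp add: u_def)
    moreover have "norm (shift_op T \<mu> (u n)) \<le> inverse (real (Suc n))" for n
      using x[of n] pos[of n] by (simp add: u_def A.scaleR pos_divide_le_eq)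
    then have "(\<lambda>n. shift_op T \<mu> (u n)) \<longlonglongrightarrow> 0"
      by (intro Lim_null_comparison[OF _ LIMSEQ_inverse_real_of_nat]) auto
    ultimately show False
      using notin unfolding approx_point_spectrum_def by blast
  qed
next
  assume "\<exists>c>0. \<forall>x. c * norm x \<le> norm (shift_op T \<mu> x)"
  then obtain c where c: "c > 0" "\<And>x. c * norm x \<le> norm (shift_op T \<mu> x)" by blast
  show "\<mu> \<notin> approx_point_spectrum T"
  proof
    assume "\<mu> \<in> approx_point_spectrum T"
    then obtain x where x: "\<And>n. norm (x n) = 1" "(\<lambda>n. shift_op T \<mu> (x n)) \<longlonglongrightarrow> 0"
      unfolding approx_point_spectrum_def by blast
    have "c \<le> norm (shift_op T \<mu> (x n))" for n
      using c(2)[of "x n"] x(1) by simp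
    then have "c \<le> 0"
      using tendsto_norm_zero[OF x(2)] by (intro LIMSEQ_le_const) auto
    with c(1) show False by simp
  qed
qed

text \<open>A lower bound \<open>c\<close> at \<open>\<mu>\<close> leaves the lower bound \<open>c / 2\<close> at distance less than \<open>c / 2\<close>.\<close>

lemma closed_approx_point_spectrum:
  fixes T :: "'a :: complex_normed_vector \<Rightarrow> 'a"
  assumes "bounded_clinear T"
  shows "closed (approx_point_spectrum T)"
  unfolding closed_def open_dist
proof (intro ballI)
  fix \<mu> assume "\<mu> \<in> - approx_point_spectrum T"
  then obtain c where c: "c > 0" "\<And>x. c * norm x \<le> norm (shift_op T \<mu> x)"
    using notin_approx_point_spectrum_iff[OF assms] by blast
  have "\<nu> \<in> - approx_point_spectrum T" if "dist \<nu> \<mu> < c / 2" for \<nu>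
  proof -
    have "c / 2 * norm x \<le> norm (shift_op T \<nu> x)" for x
    proof -
      have "shift_op T \<mu> x = shift_op T \<nu> x + (\<nu> - \<mu>) *\<^sub>C x"
        by (simp add: shift_op_def complex_vector.scale_left_diff_distrib)
      then have "norm (shift_op T \<mu> x) \<le> norm (shift_op T \<nu> x) + cmod (\<nu> - \<mu>) * norm x"
        by (metis norm_scaleC norm_triangle_ineq)
      moreover have "cmod (\<nu> - \<mu>) * norm x \<le> c / 2 * norm x"
        using that by (intro mult_right_mono) (auto simp: dist_norm)
      ultimately show ?thesis
        using c(2)[of x] by simp
    qed
    with c(1) show ?thesis
      using notin_approx_point_spectrum_iff[OF assms, of \<nu>] by (auto intro!: exI[of _ "c / 2"])
  qed
  with c(1) show "\<exists>e>0. \<forall>\<nu>. dist \<nu> \<mu> < e \<longrightarrow> \<nu> \<in> - approx_point_spectrum T"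
    by (intro exI[of _ "c / 2"]) auto
qed

lemma approx_point_spectrum_map_prod:
  fixes S :: "'a :: complex_normed_vector \<Rightarrow> 'a" and T :: "'b :: complex_normed_vector \<Rightarrow> 'b"
  assumes S: "bounded_clinear S" and T: "bounded_clinear T"
  shows "approx_point_spectrum (map_prod S T) = approx_point_spectrum S \<union> approx_point_spectrum T"
proof -
  have "\<mu> \<notin> approx_point_spectrum (map_prod S T) \<longleftrightarrow>
    \<mu> \<notin> approx_point_spectrum S \<and> \<mu> \<notin> approx_point_spectrum T" for \<mu>
  proof -
    let ?A = "shift_op S \<mu>" and ?B = "shift_op T \<mu>"
    have A0: "?A 0 = 0" and B0: "?B 0 = 0"
      using S T by (auto simp: linear_simps bounded_linear_shift_op)
    have "(\<exists>c>0. \<forall>p. c * norm p \<le> norm (map_prod ?A ?B p)) \<longleftrightarrow>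
      (\<exists>c>0. \<forall>x. c * norm x \<le> norm (?A x)) \<and> (\<exists>c>0. \<forall>y. c * norm y \<le> norm (?B y))"
    proof (intro iffI conjI)
      assume "\<exists>c>0. \<forall>p. c * norm p \<le> norm (map_prod ?A ?B p)"
      then obtain c where c: "c > 0" "\<And>p. c * norm p \<le> norm (map_prod ?A ?B p)" by blast
      have "c * norm x \<le> norm (?A x)" for x
        using c(2)[of "(x, 0)"] by (simp add: B0 norm_Pair1)
      with c(1) show "\<exists>c>0. \<forall>x. c * norm x \<le> norm (?A x)" by blast
      have "c * norm y \<le> norm (?B y)" for y
        using c(2)[of "(0, y)"] by (simp add: A0 norm_Pair2)
      with c(1) show "\<exists>c>0. \<forall>y. c * norm y \<le> norm (?B y)" by blast
    next
      assume "(\<exists>c>0. \<forall>x. c * norm x \<le> norm (?A x)) \<and> (\<exists>c>0. \<forall>y. c * norm y \<le> norm (?B y))"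
      then obtain a b where a: "a > 0" "\<And>x. a * norm x \<le> norm (?A x)"
        and b: "b > 0" "\<And>y. b * norm y \<le> norm (?B y)" by blast
      define c where "c = min a b"
      have c: "c > 0" using a(1) b(1) by (simp add: c_def)
      have "c * norm p \<le> norm (map_prod ?A ?B p)" for p
      proof (cases p)
        case (Pair x y)
        have "c * norm x \<le> norm (?A x)" "c * norm y \<le> norm (?B y)"
          by (rule order_trans[OF mult_right_mono a(2)] order_trans[OF mult_right_mono b(2)];
              simp add: c_def)+
        then have "(c * norm x)\<^sup>2 + (c * norm y)\<^sup>2 \<le> (norm (?A x))\<^sup>2 + (norm (?B y))\<^sup>2"
          using c by (intro add_mono power_mono) auto
        then have "sqrt (c\<^sup>2 * ((norm x)\<^sup>2 + (norm y)\<^sup>2)) \<le> norm (map_prod ?A ?B p)"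
          by (simp add: Pair norm_Pair power_mult_distrib distrib_left)
        then show ?thesis
          using c by (simp add: Pair norm_Pair real_sqrt_mult)
      qed
      with c show "\<exists>c>0. \<forall>p. c * norm p \<le> norm (map_prod ?A ?B p)" by blast
    qed
    then show ?thesis
      by (simp add: notin_approx_point_spectrum_iff S T bounded_clinear_map_prod shift_op_map_prod)
  qed
  then show ?thesis by blast
qed


section \<open>Nullity and eigenvalues\<close>

lemma ecdim_eq_0_iff: "ecdim V = 0 \<longleftrightarrow> V \<subseteq> {0}"
proof (cases "\<exists>B. finite B \<and> V \<subseteq> cspan B")
  case True
  then obtain C where C: "finite C" "V \<subseteq> cspan C" by blast
  obtain B where B: "B \<subseteq> V" "\<not> cdependent B" "V \<subseteq> cspan B" "card B = cdim V"
    using complex_vector.basis_exists by blast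
  have "finite B"
    using complex_vector.independent_span_bound[of C B] C B by blast
  then have "cdim V = 0 \<longleftrightarrow> V \<subseteq> {0}"
    using B complex_vector.dim_le_card[of V "{}"] by auto
  with True show ?thesis by (simp add: ecdim_def zero_enat_def)
next
  case False
  moreover have "\<not> V \<subseteq> {0}"
    using False complex_vector.span_empty finite.emptyI by metis
  moreover have "ecdim V = \<infinity>"
    unfolding ecdim_def using False by (rule if_not_P)
  ultimately show ?thesis by simp
qed

lemma is_eigenvalue_iff_nullity_pos:
  "is_eigenvalue T \<mu> \<longleftrightarrow> 0 < nullity_on UNIV (shift_op T \<mu>)"
  by (auto simp: nullity_on_def ecdim_eq_0_iff is_eigenvalue_def shift_op_def)

lemma ecdim_finite_iff: "ecdim V < \<infinity> \<longleftrightarrow> (\<exists>B. finite B \<and> V \<subseteq> cspan B)"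
  by (simp add: ecdim_def)

text \<open>
  Finite spanning sets of the factors embed into the product, and a finite spanning set of the
  product projects to both factors. Projecting \<open>U \<times> V\<close> onto \<open>U\<close> requires \<open>V\<close> to be nonempty,
  which \<open>0 \<in> V\<close> ensures.
\<close>

lemma ecdim_Times_finite_iff:
  fixes U :: "'a :: complex_normed_vector set" and V :: "'b :: complex_normed_vector set"
  assumes U: "0 \<in> U" and V: "0 \<in> V"
  shows "ecdim (U \<times> V) < \<infinity> \<longleftrightarrow> ecdim U < \<infinity> \<and> ecdim V < \<infinity>"
proof -
  interpret fst: Vector_Spaces.linear scaleC scaleC "fst :: 'a \<times> 'b \<Rightarrow> 'a"
    by unfold_locales (simp_all add: scaleC_prod_def)
  interpret snd: Vector_Spaces.linear scaleC scaleC "snd :: 'a \<times> 'b \<Rightarrow> 'b"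
    by unfold_locales (simp_all add: scaleC_prod_def)
  interpret inl: Vector_Spaces.linear scaleC scaleC "\<lambda>x :: 'a. (x, 0 :: 'b)"
    by unfold_locales (simp_all add: scaleC_prod_def)
  interpret inr: Vector_Spaces.linear scaleC scaleC "\<lambda>y :: 'b. (0 :: 'a, y)"
    by unfold_locales (simp_all add: scaleC_prod_def)
  note span_image = fst.span_image[folded cspan_raw_def] snd.span_image[folded cspan_raw_def]
    inl.span_image[folded cspan_raw_def] inr.span_image[folded cspan_raw_def]
  show ?thesis
    unfolding ecdim_finite_iff
  proof (intro iffI conjI)
    assume "\<exists>B. finite B \<and> U \<times> V \<subseteq> cspan B"
    then obtain B where B: "finite B" "U \<times> V \<subseteq> cspan B" by blast
    have "U \<subseteq> fst ` (U \<times> V)" "V \<subseteq> snd ` (U \<times> V)"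
      using U V by force+
    then have "U \<subseteq> cspan (fst ` B)" "V \<subseteq> cspan (snd ` B)"
      unfolding span_image using B(2) by blast+
    with B(1) show "\<exists>B. finite B \<and> U \<subseteq> cspan B" "\<exists>B. finite B \<and> V \<subseteq> cspan B"
      by blast+
  next
    assume "(\<exists>B. finite B \<and> U \<subseteq> cspan B) \<and> (\<exists>B. finite B \<and> V \<subseteq> cspan B)"
    then obtain C D where C: "finite C" "U \<subseteq> cspan C" and D: "finite D" "V \<subseteq> cspan D" by blast
    let ?B = "(\<lambda>x. (x, 0)) ` C \<union> (\<lambda>y. (0, y)) ` D"
    have "U \<times> V \<subseteq> cspan ?B"
    proof clarify
      fix x y assume "x \<in> U" "y \<in> V"
      then have "(x, 0) \<in> cspan ((\<lambda>x. (x, 0 :: 'b)) ` C)" "(0, y) \<in> cspan ((\<lambda>y. (0 :: 'a, y)) ` D)"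
        using C(2) D(2) by (auto simp: span_image)
      then have "(x, 0) \<in> cspan ?B" "(0, y) \<in> cspan ?B"
        using complex_vector.span_mono by blast+
      then show "(x, y) \<in> cspan ?B"
        using complex_vector.span_add by fastforce
    qed
    with C(1) D(1) show "\<exists>B. finite B \<and> U \<times> V \<subseteq> cspan B"
      by (intro exI[of _ ?B]) auto
  qed
qed

lemma nullity_map_prod_finite_iff:
  fixes S :: "'a :: complex_normed_vector \<Rightarrow> 'a" and T :: "'b :: complex_normed_vector \<Rightarrow> 'b"
  assumes "S 0 = 0" and "T 0 = 0"
  shows "nullity_on UNIV (map_prod S T) < \<infinity> \<longleftrightarrow> nullity_on UNIV S < \<infinity> \<and> nullity_on UNIV T < \<infinity>"
proof -
  have "{p \<in> UNIV. map_prod S T p = 0} = {x \<in> UNIV. S x = 0} \<times> {y \<in> UNIV. T y = 0}"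
    by (auto simp: zero_prod_def)
  then show ?thesis
    unfolding nullity_on_def by (simp only:) (rule ecdim_Times_finite_iff; simp add: assms)
qed

lemma is_eigenvalue_map_prod_iff:
  fixes S :: "'a :: complex_normed_vector \<Rightarrow> 'a" and T :: "'b :: complex_normed_vector \<Rightarrow> 'b"
  assumes "S 0 = 0" and "T 0 = 0"
  shows "is_eigenvalue (map_prod S T) \<mu> \<longleftrightarrow> is_eigenvalue S \<mu> \<or> is_eigenvalue T \<mu>"
proof
  assume "is_eigenvalue (map_prod S T) \<mu>"
  then show "is_eigenvalue S \<mu> \<or> is_eigenvalue T \<mu>"
    by (auto simp: is_eigenvalue_def scaleC_prod_def zero_prod_def)
next
  assume "is_eigenvalue S \<mu> \<or> is_eigenvalue T \<mu>"
  then obtain x y where "x \<noteq> 0 \<or> y \<noteq> 0" "S x = \<mu> *\<^sub>C x" "T y = \<mu> *\<^sub>C y"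
  proof (elim disjE)
    assume "is_eigenvalue S \<mu>"
    then show ?thesis using that[of _ 0] assms(2) by (auto simp: is_eigenvalue_def)
  next
    assume "is_eigenvalue T \<mu>"
    then show ?thesis using that[of 0] assms(1) by (auto simp: is_eigenvalue_def)
  qed
  then show "is_eigenvalue (map_prod S T) \<mu>"
    unfolding is_eigenvalue_def by (intro exI[of _ "(x, y)"]) (simp add: scaleC_prod_def zero_prod_def)
qed


section \<open>The upper semi b-Weyl spectrum\<close>

lemma notin_approx_point_spectrum_imp_nullity_0:
  fixes T :: "'a :: complex_normed_vector \<Rightarrow> 'a"
  assumes "bounded_clinear T" and "\<mu> \<notin> approx_point_spectrum T"
  shows "nullity_on UNIV (shift_op T \<mu>) = 0"
proof -
  obtain c where c: "c > 0" "\<And>x. c * norm x \<le> norm (shift_op T \<mu> x)"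
    using notin_approx_point_spectrum_iff[OF assms(1)] assms(2) by blast
  have "x = 0" if "shift_op T \<mu> x = 0" for x
    using c(1) c(2)[of x] that by (simp add: mult_le_0_iff)
  then show ?thesis
    by (auto simp: nullity_on_def ecdim_eq_0_iff)
qed

text \<open>
  An operator that is bounded below is injective with closed range, and so has nullity \<open>0\<close> and
  index at most \<open>0\<close>: in the definition of an upper semi b-Weyl operator the power \<open>n = 0\<close> will do.
\<close>

lemma usbw_spectrum_subset:
  fixes T :: "'a :: complex_banach \<Rightarrow> 'a"
  assumes "bounded_clinear T"
  shows "usbw_spectrum T \<subseteq> approx_point_spectrum T"
proof
  fix \<mu> assume usbw: "\<mu> \<in> usbw_spectrum T"
  show "\<mu> \<in> approx_point_spectrum T"
  proof (rule ccontr)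
    assume "\<mu> \<notin> approx_point_spectrum T"
    then obtain c where c: "c > 0" "\<And>x. c * norm x \<le> norm (shift_op T \<mu> x)"
      using notin_approx_point_spectrum_iff[OF assms] by blast
    have "complete (range (shift_op T \<mu>))"
      using c by (intro complete_isometric_image[OF c(1)] bounded_linear_shift_op assms)
        (auto simp: complete_UNIV)
    then have "closed (range (shift_op T \<mu>))"
      by (rule complete_imp_closed)
    moreover have "nullity_on UNIV (shift_op T \<mu>) = 0"
      using \<open>\<mu> \<notin> approx_point_spectrum T\<close> by (rule notin_approx_point_spectrum_imp_nullity_0[OF assms])
    ultimately have "upper_semi_Weyl_on UNIV (shift_op T \<mu>)"
      by (simp add: upper_semi_Weyl_on_def upper_semi_Fredholm_on_def index_on_def)
    then have "upper_semi_b_Weyl (shift_op T \<mu>)"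
      unfolding upper_semi_b_Weyl_def by (intro exI[of _ 0]) simp
    with usbw show False by (simp add: usbw_spectrum_def)
  qed
qed

lemma notin_usbw_spectrum_iff:
  fixes T :: "'a :: complex_banach \<Rightarrow> 'a"
  assumes "bounded_clinear T" and "property_sbaw T"
  shows "\<mu> \<notin> usbw_spectrum T \<longleftrightarrow> \<mu> \<notin> approx_point_spectrum T \<or> \<mu> \<in> pi00a T"
  using usbw_spectrum_subset[OF assms(1)] assms(2) unfolding property_sbaw_def by blast


section \<open>Isolated eigenvalues of finite multiplicity of a direct sum\<close>

lemma pi00a_iff:
  "\<mu> \<in> pi00a T \<longleftrightarrow> \<mu> isolated_in approx_point_spectrum T \<and> is_eigenvalue T \<mu>
     \<and> nullity_on UNIV (shift_op T \<mu>) < \<infinity>"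
  by (auto simp: pi00a_def fin_mult_eigenvalues_def is_eigenvalue_iff_nullity_pos)

text \<open>Closedness keeps a point of one set only from being a limit point of the other.\<close>

lemma isolated_in_Un_iff:
  fixes A B :: "'a :: topological_space set"
  assumes A: "closed A" and B: "closed B"
  shows "x isolated_in (A \<union> B) \<longleftrightarrow>
    x \<in> A \<union> B \<and> (x \<in> A \<longrightarrow> x isolated_in A) \<and> (x \<in> B \<longrightarrow> x isolated_in B)"
proof -
  have closed: "\<not> x islimpt C" if "closed C" "x \<notin> C" for C
    using that by (auto simp: closed_limpt)
  show ?thesis
    using closed[OF A] closed[OF B] by (auto simp: isolated_in_islimpt_iff islimpt_Un)
qed

text \<open>
  A-isoloidness is what separates the summands: finite multiplicity for the direct sum gives finite
  multiplicity for both, but an eigenvalue of the direct sum is in general an eigenvalue of one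
  summand only. If \<open>\<mu>\<close> is isolated in the union and lies in the approximate point spectrum of one
  summand, it is isolated there, hence an eigenvalue of that summand.
\<close>

lemma pi00a_map_prod_iff:
  fixes S :: "'a :: complex_normed_vector \<Rightarrow> 'a" and T :: "'b :: complex_normed_vector \<Rightarrow> 'b"
  assumes S: "bounded_clinear S" and T: "bounded_clinear T"
    and "a_isoloid S" and "a_isoloid T"
  shows "\<mu> \<in> pi00a (map_prod S T) \<longleftrightarrow>
    \<mu> \<in> approx_point_spectrum S \<union> approx_point_spectrum T
    \<and> (\<mu> \<notin> approx_point_spectrum S \<or> \<mu> \<in> pi00a S)
    \<and> (\<mu> \<notin> approx_point_spectrum T \<or> \<mu> \<in> pi00a T)"
proof -
  have zero: "S 0 = 0" "T 0 = 0" "shift_op S \<mu> 0 = 0" "shift_op T \<mu> 0 = 0"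
    using S T by (auto simp: linear_simps bounded_linear_shift_op bounded_clinear_def)
  have isoloid: "\<mu> isolated_in approx_point_spectrum S \<Longrightarrow> is_eigenvalue S \<mu>"
    "\<mu> isolated_in approx_point_spectrum T \<Longrightarrow> is_eigenvalue T \<mu>"
    using assms(3,4) by (auto simp: a_isoloid_def)
  have regular: "\<mu> \<notin> approx_point_spectrum S \<Longrightarrow> nullity_on UNIV (shift_op S \<mu>) < \<infinity>"
    "\<mu> \<notin> approx_point_spectrum T \<Longrightarrow> nullity_on UNIV (shift_op T \<mu>) < \<infinity>"
    using notin_approx_point_spectrum_imp_nullity_0[OF S]
      notin_approx_point_spectrum_imp_nullity_0[OF T] by simp_all
  show ?thesis
    unfolding pi00a_iff approx_point_spectrum_map_prod[OF S T] shift_op_map_prod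
      isolated_in_Un_iff[OF closed_approx_point_spectrum[OF S] closed_approx_point_spectrum[OF T]]
      nullity_map_prod_finite_iff[of "shift_op S \<mu>" "shift_op T \<mu>", OF zero(3,4)]
      is_eigenvalue_map_prod_iff[of S T, OF zero(1,2)]
    using isoloid regular by auto
qed


section \<open>Property \<open>(sbaw)\<close> of a direct sum\<close>

theorem theorem5p1:
  fixes S :: "'a :: complex_banach \<Rightarrow> 'a" and T :: "'b :: complex_banach \<Rightarrow> 'b"
  assumes "ecdim (UNIV :: 'a set) = \<infinity>" and "ecdim (UNIV :: 'b set) = \<infinity>"
    and "bounded_clinear S" and "bounded_clinear T"
    and "property_sbaw S" and "property_sbaw T"
    and "a_isoloid S" and "a_isoloid T"
  shows "property_sbaw (map_prod S T) \<longleftrightarrow>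
         usbw_spectrum (map_prod S T) = usbw_spectrum S \<union> usbw_spectrum T"
proof -
  let ?P = "map_prod S T"
  note spectrum = approx_point_spectrum_map_prod[OF assms(3,4)]
  have pi: "\<mu> \<in> pi00a ?P \<longleftrightarrow> \<mu> \<in> approx_point_spectrum ?P \<and> \<mu> \<notin> usbw_spectrum S \<union> usbw_spectrum T"
    for \<mu>
    using pi00a_map_prod_iff[OF assms(3,4,7,8)] spectrum
      notin_usbw_spectrum_iff[OF assms(3,5)] notin_usbw_spectrum_iff[OF assms(4,6)] by blast
  have "usbw_spectrum ?P \<subseteq> approx_point_spectrum ?P"
    using usbw_spectrum_subset[OF bounded_clinear_map_prod[OF assms(3,4)]] .
  moreover have "usbw_spectrum S \<union> usbw_spectrum T \<subseteq> approx_point_spectrum ?P"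
    using usbw_spectrum_subset[OF assms(3)] usbw_spectrum_subset[OF assms(4)] spectrum by blast
  ultimately show ?thesis
    unfolding property_sbaw_def set_eq_iff using pi by blast
qed

end
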